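(* Let $b,c,f:[0,1]\to\mathbb{R}$ be smooth and let $\beta,\gamma>0$ be such that $b>\beta$, $c\ge0$ and $c+b'/2\ge\gamma$ on $[0,1]$. Then there is a constant $C$, independent of $\varepsilon$, $\underline\varepsilon$ and $\overline\varepsilon$, such that for every smooth $\varepsilon:[0,1]\to\mathbb{R}$ with $0<\underline\varepsilon\le\varepsilon(x)\le\overline\varepsilon\le1$ and $\varepsilon'(x)\ge0$ on $[0,1]$ the following holds. Let $\mathcal{L}_\varepsilon v=-(\varepsilon v')'-bv'+cv$, let $u$ be the solution of $\mathcal{L}_\varepsilon u=f$ in $(0,1)$, $u(0)=u(1)=0$, and let $e(t)=\int_0^t\frac{1}{\varepsilon(z)}\,dz$. There exists a constant $S_0$ with $|S_0|\le C$ such that $u=S+E^{BL}$, where $S$ and $E^{BL}$ solve the boundary value problems $$\mathcal{L}_\varepsilon S=f\ \text{ in }(0,1),\quad S(0)=S_0,\quad S(1)=0,$$ $$\mathcal{L}_\varepsilon E^{BL}=0\ \text{ in }(0,1),\quad E^{BL}(0)=-S_0,\quad E^{BL}(1)=0,$$ and for all $x\in[0,1]$ $$|S^{(k)}(x)|\le C\quad\text{for }k=0,1,$$ $$|S''(x)|\le C\,\frac{1+\varepsilon'(x)}{\varepsilon(x)},$$ $$|\varepsilon(x)S''(x)+\varepsilon'(x)S'(x)|\le C,$$ $$\big|(E^{BL})^{(k)}(x)\big|\le C\,\frac{1}{\varepsilon(x)^k}\,\mathrm{e}^{-\beta e(x)}\quad\text{for }k=0,1,$$ $$\big|(E^{BL})''(x)\big|\le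 C\,\frac{1+\varepsilon'(x)}{\varepsilon(x)^2}\,\mathrm{e}^{-\beta e(x)}.$$
   Context: The constant $C$ may depend on $b,c,f,\beta,\gamma$ but not on the diffusion coefficient $\varepsilon$ (nor on its bounds $\underline\varepsilon,\overline\varepsilon$). *)

theory Defs
  imports "HOL-Analysis.Analysis"
begin

(* Derivatives on the compact interval [0,1]; one-sided at the endpoints. *)

definition deriv01 :: "(real \<Rightarrow> real) \<Rightarrow> real \<Rightarrow> real" where
  "deriv01 g x = vector_derivative g (at x within {0..1})"

definition Ck01 :: "nat \<Rightarrow> (real \<Rightarrow> real) \<Rightarrow> bool" where
  "Ck01 k g \<longleftrightarrow>
     (\<forall>j<k. (deriv01 ^^ j) g differentiable_on {0..1}) \<and>
     continuous_on {0..1} ((deriv01 ^^ k) g)"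

definition smooth01 :: "(real \<Rightarrow> real) \<Rightarrow> bool" where
  "smooth01 g \<longleftrightarrow> (\<forall>k. Ck01 k g)"

definition Lop ::
  "(real \<Rightarrow> real) \<Rightarrow> (real \<Rightarrow> real) \<Rightarrow> (real \<Rightarrow> real) \<Rightarrow> (real \<Rightarrow> real) \<Rightarrow> real \<Rightarrow> real" where
  "Lop b c \<epsilon> v x =
     - deriv01 (\<lambda>t. \<epsilon> t * deriv01 v t) x - b x * deriv01 v x + c x * v x"

(* Classical solutions: twice continuously differentiable up to the boundary. *)

definition solves_bvp ::
  "(real \<Rightarrow> real) \<Rightarrow> (real \<Rightarrow> real) \<Rightarrow> (real \<Rightarrow> real) \<Rightarrow> (real \<Rightarrow> real) \<Rightarrow>
   real \<Rightarrow> real \<Rightarrow> (real \<Rightarrow> real) \<Rightarrow> bool" where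
  "solves_bvp b c \<epsilon> g v0 v1 v \<longleftrightarrow>
     Ck01 2 v \<and> (\<forall>x\<in>{0<..<1}. Lop b c \<epsilon> v x = g x) \<and> v 0 = v0 \<and> v 1 = v1"

definition stretch :: "(real \<Rightarrow> real) \<Rightarrow> real \<Rightarrow> real" where
  "stretch \<epsilon> t = integral {0..t} (\<lambda>z. 1 / \<epsilon> z)"

end

theory Submission
  imports Defs
begin

text \<open>Normalise the smooth part by \<open>S'(0) = 0\<close>, \<open>S(1) = 0\<close>, so that the layer part \<open>E = u - S\<close>
  solves the homogeneous equation with \<open>E'(0) = u'(0)\<close>, \<open>E(1) = 0\<close>. The maximum principle bounds
  \<open>S\<close> by a multiple of \<open>1 - x\<close> and \<open>E\<close> by a multiple of \<open>exp (- \<beta> e)\<close>. With \<open>P' = b / \<epsilon>\<close> the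
  equation reads \<open>(\<epsilon> v' exp P)' = (c v - g) exp P\<close>, and integrating it from \<open>0\<close> bounds both first
  derivatives; the second derivatives then follow from the equation itself.\<close>

text \<open>The value of \<open>S\<close> at 0 that keeps it free of a layer is not known
  beforehand, while u'(0) may be of size 1/\<epsilon>(0). Prescribing zero slope for
  \<open>S\<close> puts this steep slope into \<open>E\<close>, and S(0), hence S_0, comes out as a
  bounded quantity. The zero slope also removes the initial flux from the integrated equation for
  \<open>S\<close>. For \<open>E\<close> that flux remains: a bound on \<epsilon>(0) E'(0) uniform
  in \<epsilon> has to be found separately, and this is where b' enters. Existence of
  \<open>E\<close> is a separate, purely qualitative matter: a Picard series solves initial value
  problems and shooting adjusts the value at 1. The majorants used for convergence may depend badly
  on \<epsilon>. Every uniform bound comes from comparison or from integrating the equation.\<close>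

section \<open>Integration and termwise differentiation on the unit interval\<close>

text \<open>Integrating an estimate amounts to finding an explicit majorant \<open>k\<close> and
  comparing derivatives pointwise. The gauge integral makes the fundamental theorem available
  without continuity of \<open>h'\<close> or \<open>k'\<close>.\<close>

lemma abs_increment_le:
  fixes h k :: "real \<Rightarrow> real"
  assumes h: "\<And>t. t \<in> {0..1} \<Longrightarrow> (h has_real_derivative h' t) (at t within {0..1})"
    and k: "\<And>t. t \<in> {0..1} \<Longrightarrow> (k has_real_derivative k' t) (at t within {0..1})"
    and le: "\<And>t. t \<in> {0..x} \<Longrightarrow> \<bar>h' t\<bar> \<le> k' t"
    and x: "x \<in> {0..1}"
  shows "\<bar>h x - h 0\<bar> \<le> k x - k 0"
proof -
  have sub: "(g has_vector_derivative g' t) (at t within {0..x})"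
    if "\<And>t. t \<in> {0..1} \<Longrightarrow> (g has_real_derivative g' t) (at t within {0..1})" "t \<in> {0..x}"
    for g g' :: "real \<Rightarrow> real" and t
    using that x has_field_derivative_subset[of g "g' t" t "{0..1}" "{0..x}"]
    by (auto simp: has_real_derivative_iff_has_vector_derivative)
  have "(h' has_integral h x - h 0) {0..x}" "(k' has_integral k x - k 0) {0..x}"
    using x by (auto intro!: fundamental_theorem_of_calculus sub h k)
  moreover from this(1) have "((\<lambda>t. - h' t) has_integral - (h x - h 0)) {0..x}"
    by (rule has_integral_neg)
  ultimately show ?thesis
    using has_integral_le[of h' "h x - h 0" "{0..x}" k' "k x - k 0"]
      has_integral_le[of "\<lambda>t. - h' t" "- (h x - h 0)" "{0..x}" k' "k x - k 0"] le
    by (force simp: abs_le_iff)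
qed

lemma integral_deriv01:
  fixes g :: "real \<Rightarrow> real"
  assumes "continuous_on {0..1} g" "x \<in> {0..1}"
  shows "((\<lambda>t. integral {0..t} g) has_real_derivative g x) (at x within {0..1})"
  using assms by (intro integral_has_real_derivative) auto

lemma has_real_derivative_cong01:
  fixes f g :: "real \<Rightarrow> real"
  assumes "(f has_real_derivative d) (at x within {0..1})" "x \<in> {0..1}"
    and "\<And>t. t \<in> {0..1} \<Longrightarrow> f t = g t"
  shows "(g has_real_derivative d) (at x within {0..1})"
  using assms by (intro has_field_derivative_transform_within[of f d x "{0..1}" 1 g]) auto

lemma has_real_derivative_suminf:
  fixes F F' :: "nat \<Rightarrow> real \<Rightarrow> real"
  assumes F: "\<And>n x. x \<in> {0..1} \<Longrightarrow> (F n has_real_derivative F' n x) (at x within {0..1})"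
    and sumF: "\<And>x. x \<in> {0..1} \<Longrightarrow> summable (\<lambda>n. F n x)"
    and bound: "\<And>n x. x \<in> {0..1} \<Longrightarrow> \<bar>F' n x\<bar> \<le> B n" and B: "summable B"
    and x: "x \<in> {0..1}"
  shows "((\<lambda>x. \<Sum>n. F n x) has_real_derivative (\<Sum>n. F' n x)) (at x within {0..1})"
proof -
  have "uniform_limit {0..1} (\<lambda>n x. \<Sum>i<n. F' i x) (\<lambda>x. \<Sum>i. F' i x) sequentially"
    using bound B by (intro Weierstrass_m_test) auto
  then obtain g where g: "\<forall>x\<in>{0..1}. (\<lambda>n. F n x) sums g x \<and>
      (g has_real_derivative (\<Sum>i. F' i x)) (at x within {0..1})"
    using has_field_derivative_series[of "{0..1}" F F' "\<lambda>x. \<Sum>i. F' i x" 0] F sumF by auto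
  show ?thesis
    by (rule has_real_derivative_cong01[of g]) (use g x in \<open>auto simp: sums_iff\<close>)
qed

section \<open>Linear systems by Picard iteration\<close>

text \<open>These are the increments of the Picard iteration, not the iterates: the solution is the
  sum over \<open>n\<close>. The two components feed each other, as in k' = G m, m' = H k.\<close>

primrec picard :: "(real \<Rightarrow> real) \<Rightarrow> (real \<Rightarrow> real) \<Rightarrow> real \<Rightarrow> real \<Rightarrow> nat \<Rightarrow> (real \<Rightarrow> real) \<times> (real \<Rightarrow> real)"
  where
    "picard G H p q 0 = ((\<lambda>x. p), (\<lambda>x. q))"
  | "picard G H p q (Suc n) =
      ((\<lambda>x. integral {0..x} (\<lambda>t. G t * snd (picard G H p q n) t)),
       (\<lambda>x. integral {0..x} (\<lambda>t. H t * fst (picard G H p q n) t)))"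

text \<open>A system without diagonal terms suffices, because the integrating factor absorbs the
  convection term. The increments are dominated by \<open>A * (B * x) ^ n / fact n\<close>, so both
  the series and its termwise derivative converge uniformly.\<close>

lemma linear_system_solution:
  fixes G H :: "real \<Rightarrow> real"
  assumes G: "continuous_on {0..1} G" and H: "continuous_on {0..1} H"
  obtains k m where "k 0 = p" "m 0 = q"
    "\<And>x. x \<in> {0..1} \<Longrightarrow> (k has_real_derivative G x * m x) (at x within {0..1})"
    "\<And>x. x \<in> {0..1} \<Longrightarrow> (m has_real_derivative H x * k x) (at x within {0..1})"
proof -
  define I :: "real set" where "I = {0..1}"
  define K where "K n = fst (picard G H p q n)" for n
  define L where "L n = snd (picard G H p q n)" for n
  define K' where "K' n = (case n of 0 \<Rightarrow> (\<lambda>x. 0) | Suc j \<Rightarrow> (\<lambda>x. G x * L j x))" for n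
  define L' where "L' n = (case n of 0 \<Rightarrow> (\<lambda>x. 0) | Suc j \<Rightarrow> (\<lambda>x. H x * K j x))" for n
  have KL0: "K 0 = (\<lambda>x. p)" "L 0 = (\<lambda>x. q)"
    and KS: "K (Suc n) = (\<lambda>x. integral {0..x} (\<lambda>t. G t * L n t))"
    and LS: "L (Suc n) = (\<lambda>x. integral {0..x} (\<lambda>t. H t * K n t))" for n
    by (simp_all add: K_def L_def)
  have der: "\<forall>x\<in>I. (K n has_real_derivative K' n x) (at x within I) \<and>
      (L n has_real_derivative L' n x) (at x within I)" for n
  proof (induction n)
    case 0
    show ?case by (simp add: KL0 K'_def L'_def)
  next
    case (Suc n)
    have "continuous_on I (K n)" "continuous_on I (L n)"
      using Suc by (blast intro: DERIV_continuous_on)+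
    then show ?case
      using G H
      by (auto simp: I_def KS LS K'_def L'_def intro!: integral_deriv01 continuous_intros)
  qed
  obtain B where B: "\<And>x. x \<in> I \<Longrightarrow> \<bar>G x\<bar> \<le> B" "\<And>x. x \<in> I \<Longrightarrow> \<bar>H x\<bar> \<le> B"
  proof -
    have "bounded (G ` I)" "bounded (H ` I)"
      unfolding I_def by (intro compact_imp_bounded compact_continuous_image G H compact_Icc)+
    then obtain B1 B2 where "\<forall>x\<in>I. \<bar>G x\<bar> \<le> B1" "\<forall>x\<in>I. \<bar>H x\<bar> \<le> B2"
      by (auto simp: bounded_iff)
    then show thesis
      by (intro that[of "max B1 B2"]) fastforce+
  qed
  have B0: "B \<ge> 0" using B(1)[of 0] by (auto simp: I_def)
  define A where "A = max \<bar>p\<bar> \<bar>q\<bar>"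
  have bound: "\<forall>x\<in>I. \<bar>K n x\<bar> \<le> A * B ^ n * x ^ n / fact n \<and> \<bar>L n x\<bar> \<le> A * B ^ n * x ^ n / fact n" for n
  proof (induction n)
    case 0
    show ?case by (auto simp: KL0 A_def)
  next
    case (Suc n)
    \<comment> \<open>The next bound is chosen so that its derivative is \<open>B\<close> times the
      current one and it vanishes at 0.\<close>
    define k where "k = (\<lambda>x. A * B ^ Suc n * x ^ Suc n / fact (Suc n))"
    have k: "(k has_real_derivative B * (A * B ^ n * x ^ n / fact n)) (at x within {0..1})" for x
      unfolding k_def by (rule derivative_eq_intros refl | simp add: field_simps del: of_nat_Suc)+
    have "\<bar>K (Suc n) x - K (Suc n) 0\<bar> \<le> k x - k 0" if "x \<in> I" for x
    proof (rule abs_increment_le[OF _ k, where h' = "K' (Suc n)"])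
      fix t assume "t \<in> {0..x}"
      then have "t \<in> I" using that by (auto simp: I_def)
      then show "\<bar>K' (Suc n) t\<bar> \<le> B * (A * B ^ n * t ^ n / fact n)"
        unfolding K'_def abs_mult nat.case using Suc B B0 by (intro mult_mono) auto
    qed (use that der in \<open>auto simp: I_def\<close>)
    moreover have "\<bar>L (Suc n) x - L (Suc n) 0\<bar> \<le> k x - k 0" if "x \<in> I" for x
    proof (rule abs_increment_le[OF _ k, where h' = "L' (Suc n)"])
      fix t assume "t \<in> {0..x}"
      then have "t \<in> I" using that by (auto simp: I_def)
      then show "\<bar>L' (Suc n) t\<bar> \<le> B * (A * B ^ n * t ^ n / fact n)"
        unfolding L'_def abs_mult nat.case using Suc B B0 by (intro mult_mono) auto
    qed (use that der in \<open>auto simp: I_def\<close>)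
    ultimately show ?case
      by (auto simp: k_def KS LS)
  qed
  define E where "E n = A * (B ^ n / fact n)" for n
  have sumE: "summable E"
    unfolding E_def using summable_exp[of B]
    by (intro summable_mult) (simp add: divide_inverse mult.commute)
  have bE: "\<bar>K n x\<bar> \<le> E n" "\<bar>L n x\<bar> \<le> E n" if "x \<in> I" for n x
  proof -
    have "x ^ n \<le> 1" using that by (auto simp: I_def intro!: power_le_one)
    then have "(A * B ^ n / fact n) * x ^ n \<le> (A * B ^ n / fact n) * 1"
      using B0 by (intro mult_left_mono) (auto simp: A_def)
    then show "\<bar>K n x\<bar> \<le> E n" "\<bar>L n x\<bar> \<le> E n"
      using bound[of n] that by (fastforce simp: E_def)+
  qed
  define k where "k x = (\<Sum>n. K n x)" for x
  define m where "m x = (\<Sum>n. L n x)" for x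
  have sumK: "(\<lambda>n. K n x) sums k x" and sumL: "(\<lambda>n. L n x) sums m x" if "x \<in> I" for x
    using that bE unfolding k_def m_def
    by (auto intro!: summable_sums summable_comparison_test'[OF sumE])
  define E' where "E' n = (case n of 0 \<Rightarrow> 0 | Suc j \<Rightarrow> B * E j)" for n
  have sumE': "summable E'"
    using sumE by (subst summable_Suc_iff[symmetric]) (auto simp: E'_def intro: summable_mult)
  have bE': "\<bar>K' n x\<bar> \<le> E' n" "\<bar>L' n x\<bar> \<le> E' n" if "x \<in> I" for n x
    using that bE B B0
    by (cases n; auto simp: K'_def L'_def E'_def abs_mult intro!: mult_mono)+
  have dk: "(k has_real_derivative (\<Sum>n. K' n x)) (at x within I)"
    and dm: "(m has_real_derivative (\<Sum>n. L' n x)) (at x within I)" if "x \<in> I" for x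
    using that der sumK sumL bE' sumE' unfolding k_def m_def I_def
    by (auto intro!: has_real_derivative_suminf simp: sums_iff)
  \<comment> \<open>The constant initial term has derivative 0 and each later derivative is
    \<open>G\<close> times the preceding \<open>L\<close>, so the derivative series is the series
    for \<open>m\<close>, shifted by one index and multiplied by \<open>G x\<close>.\<close>
  have "(\<lambda>n. K' n x) sums (G x * m x)" if "x \<in> I" for x
    by (rule sums_Suc_imp) (use sums_mult[OF sumL[OF that], of "G x"] in \<open>simp_all add: K'_def\<close>)
  moreover have "(\<lambda>n. L' n x) sums (H x * k x)" if "x \<in> I" for x
    by (rule sums_Suc_imp) (use sums_mult[OF sumK[OF that], of "H x"] in \<open>simp_all add: L'_def\<close>)
  ultimately have "(\<Sum>n. K' n x) = G x * m x" "(\<Sum>n. L' n x) = H x * k x" if "x \<in> I" for x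
    using that by (auto simp: sums_iff)
  moreover have "k 0 = p" "m 0 = q"
  proof -
    have "K n 0 = (if n = 0 then p else 0)" "L n 0 = (if n = 0 then q else 0)" for n
      by (cases n; simp add: KL0 KS LS)+
    then show "k 0 = p" "m 0 = q"
      using sums_unique[OF sums_single[of 0 "\<lambda>_. p"]] sums_unique[OF sums_single[of 0 "\<lambda>_. q"]]
      by (simp_all add: k_def m_def)
  qed
  ultimately show thesis
    using that[of k m] dk dm by (auto simp: I_def)
qed

section \<open>One-sided derivatives and bounds on the unit interval\<close>

lemma deriv01_eq:
  assumes "(g has_real_derivative d) (at x within {0..1})" "x \<in> {0..1}"
  shows "deriv01 g x = d"
  using assms vector_derivative_within_cbox[of 0 1 x g d]
  by (simp add: deriv01_def has_real_derivative_iff_has_vector_derivative)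

lemma deriv01_cong:
  assumes "\<And>t. t \<in> {0..1} \<Longrightarrow> f t = g t" "x \<in> {0..1}"
    and "(f has_real_derivative d) (at x within {0..1})"
  shows "deriv01 g x = d"
  by (rule deriv01_eq[OF has_real_derivative_cong01[of f]]) (use assms in auto)

lemma Ck01_has_real_derivative:
  assumes "Ck01 k g" "j < k" "x \<in> {0..1}"
  shows "((deriv01 ^^ j) g has_real_derivative (deriv01 ^^ Suc j) g x) (at x within {0..1})"
  using assms unfolding Ck01_def differentiable_on_def
  by (simp add: has_real_derivative_iff_has_vector_derivative deriv01_def vector_derivative_works)

lemma smooth01_has_real_derivative:
  assumes "smooth01 g" "x \<in> {0..1}"
  shows "(g has_real_derivative deriv01 g x) (at x within {0..1})"
  using Ck01_has_real_derivative[of 1 g 0 x] assms by (simp add: smooth01_def)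

lemma smooth01_continuous_on:
  assumes "smooth01 g"
  shows "continuous_on {0..1} g" "continuous_on {0..1} (deriv01 g)"
  using assms[unfolded smooth01_def, rule_format, of 0] assms[unfolded smooth01_def, rule_format, of 1]
  by (simp_all add: Ck01_def)

lemma continuous_on_bound01:
  fixes g :: "real \<Rightarrow> real"
  assumes "continuous_on {0..1} g"
  obtains K where "\<And>x. x \<in> {0..1} \<Longrightarrow> \<bar>g x\<bar> \<le> K"
proof -
  have "bounded (g ` {0..1})"
    by (intro compact_imp_bounded compact_continuous_image assms compact_Icc)
  then obtain K where "\<forall>x\<in>{0..1}. \<bar>g x\<bar> \<le> K"
    by (auto simp: bounded_iff)
  then show thesis
    by (intro that[of K]) auto
qed

section \<open>The equation in flux form and its comparison principle\<close>

text \<open>A single diffusion coefficient is fixed here. The constants in the estimates below are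
  built from \<beta> and bounds on \<open>b\<close>, \<open>b'\<close>, \<open>c\<close> and the
  right-hand side, which is what later gives a constant independent of \<epsilon>.\<close>

locale layer_problem =
  fixes b c \<epsilon> \<epsilon>' :: "real \<Rightarrow> real" and \<beta> :: real
  assumes cont_b: "continuous_on {0..1} b"
    and cont_c: "continuous_on {0..1} c"
    and \<beta>_pos: "\<beta> > 0"
    and b_gt: "x \<in> {0..1} \<Longrightarrow> b x > \<beta>"
    and c_nonneg: "x \<in> {0..1} \<Longrightarrow> c x \<ge> 0"
    and \<epsilon>_deriv: "x \<in> {0..1} \<Longrightarrow> (\<epsilon> has_real_derivative \<epsilon>' x) (at x within {0..1})"
    and cont_\<epsilon>': "continuous_on {0..1} \<epsilon>'"
    and \<epsilon>'_nonneg: "x \<in> {0..1} \<Longrightarrow> \<epsilon>' x \<ge> 0"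
    and \<epsilon>_pos: "x \<in> {0..1} \<Longrightarrow> \<epsilon> x > 0"
    and \<epsilon>_le_1: "x \<in> {0..1} \<Longrightarrow> \<epsilon> x \<le> 1"
begin

text \<open>The equation in flux form, with \<^term>\<open>v'\<close> the derivative of \<^term>\<open>v\<close>. Any \<^term>\<open>v\<close> with
  differentiable flux is a solution for a suitable right-hand side, so barriers fit in as well.\<close>

definition sol :: "(real \<Rightarrow> real) \<Rightarrow> (real \<Rightarrow> real) \<Rightarrow> (real \<Rightarrow> real) \<Rightarrow> bool" where
  "sol g v v' \<longleftrightarrow> (\<forall>x\<in>{0..1}. (v has_real_derivative v' x) (at x within {0..1}) \<and>
     ((\<lambda>t. \<epsilon> t * v' t) has_real_derivative c x * v x - b x * v' x - g x) (at x within {0..1}))"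

lemma cont_\<epsilon>: "continuous_on {0..1} \<epsilon>"
  using \<epsilon>_deriv by (rule DERIV_continuous_on)

lemma \<epsilon>_neq_0: "x \<in> {0..1} \<Longrightarrow> \<epsilon> x \<noteq> 0"
  using \<epsilon>_pos by force

lemma sol_deriv:
  assumes "sol g v v'" "x \<in> {0..1}"
  shows "(v has_real_derivative v' x) (at x within {0..1})"
    and "((\<lambda>t. \<epsilon> t * v' t) has_real_derivative c x * v x - b x * v' x - g x) (at x within {0..1})"
  using assms by (auto simp: sol_def)

lemma sol_linear:
  assumes "sol g v v'" "sol h w w'"
  shows "sol (\<lambda>x. g x + a * h x) (\<lambda>x. v x + a * w x) (\<lambda>x. v' x + a * w' x)"
  unfolding sol_def
proof (intro ballI conjI)
  fix x :: real assume x: "x \<in> {0..1}"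
  note d = sol_deriv[OF assms(1) x] sol_deriv[OF assms(2) x]
  show "((\<lambda>x. v x + a * w x) has_real_derivative v' x + a * w' x) (at x within {0..1})"
    using d by (auto intro!: derivative_eq_intros)
  have "((\<lambda>t. \<epsilon> t * v' t + a * (\<epsilon> t * w' t)) has_real_derivative
      (c x * v x - b x * v' x - g x) + a * (c x * w x - b x * w' x - h x)) (at x within {0..1})"
    by (intro DERIV_add DERIV_cmult d)
  then show "((\<lambda>t. \<epsilon> t * (v' t + a * w' t)) has_real_derivative
      c x * (v x + a * w x) - b x * (v' x + a * w' x) - (g x + a * h x)) (at x within {0..1})"
    by (simp add: algebra_simps)
qed

text \<open>At a negative minimum \<open>m < 1\<close> the slope is at most 0: it vanishes in the
  interior, and at 0 the left condition applies. A negative slope makes \<open>v\<close> drop to the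
  right of \<open>m\<close>. With slope 0 the derivative of the flux is negative, so the flux, and
  with it v', is negative just to the right of \<open>m\<close>; the mean value theorem again makes
  \<open>v\<close> drop. The alternative at 0 serves both parts: the slope condition for
  \<open>S\<close>, the boundary value for \<open>E\<close>.\<close>

lemma sol_nonneg:
  assumes sol: "sol g v v'" and g: "\<And>x. x \<in> {0..1} \<Longrightarrow> g x > 0"
    and left: "v 0 \<ge> 0 \<or> v' 0 \<le> 0" and right: "v 1 \<ge> 0"
    and x: "x \<in> {0..1}"
  shows "v x \<ge> 0"
proof -
  note dv = sol_deriv(1)[OF sol] and dw = sol_deriv(2)[OF sol]
  have "continuous_on {0..1} v"
    using dv by (rule DERIV_continuous_on)
  then obtain m where m: "m \<in> {0..1}" and min: "\<And>t. t \<in> {0..1} \<Longrightarrow> v m \<le> v t"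
    using continuous_attains_inf[of "{0..1::real}" v] by auto
  have "v m \<ge> 0"
  proof (rule ccontr)
    assume neg: "\<not> v m \<ge> 0"
    with right have m1: "m < 1" using m by (cases "m = 1") auto
    have v'm: "v' m \<le> 0"
    proof (cases "m = 0")
      case True
      then show ?thesis using left neg by auto
    next
      case False
      then have "m \<in> interior {0..1}" using m m1 by auto
      then have "(v has_real_derivative v' m) (at m)"
        using dv[OF m] at_within_interior[of m "{0..1}"] by simp
      then show ?thesis
        using DERIV_local_min[of v "v' m" m "min m (1 - m)"] min False m m1
        by (auto simp: abs_if split: if_splits)
    qed
    show False
    proof (cases "v' m < 0")
      case True
      from has_real_derivative_neg_dec_right[OF dv[OF m] this]
      obtain d where d: "d > 0" "\<And>h. 0 < h \<Longrightarrow> m + h \<in> {0..1} \<Longrightarrow> h < d \<Longrightarrow> v (m + h) < v m"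
        by blast
      define h where "h = min (d / 2) (1 - m)"
      have "0 < h" "m + h \<in> {0..1}" "h < d" using d(1) m m1 by (auto simp: h_def min_def field_simps)
      then show False using d(2)[of h] min[of "m + h"] by auto
    next
      case False
      then have v'0: "v' m = 0" using v'm by simp
      have "c m * v m \<le> 0"
        using c_nonneg[OF m] neg by (simp add: mult_nonneg_nonpos)
      then have "c m * v m - b m * v' m - g m < 0"
        using g[OF m] v'0 by simp
      from has_real_derivative_neg_dec_right[OF dw[OF m] this] v'0
      obtain d where d: "d > 0"
        "\<And>h. 0 < h \<Longrightarrow> m + h \<in> {0..1} \<Longrightarrow> h < d \<Longrightarrow> \<epsilon> (m + h) * v' (m + h) < 0"
        by auto
      define h where "h = min (d / 2) (1 - m)"
      have h: "0 < h" "m + h \<in> {0..1}" "h < d" using d(1) m m1 by (auto simp: h_def min_def field_simps)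
      have "\<exists>z\<in>{m<..<m + h}. v (m + h) - v m = v' z * (m + h - m)"
      proof (rule mvt_simple)
        fix t assume t: "m \<le> t" "t \<le> m + h"
        then have "(v has_real_derivative v' t) (at t within {m..m + h})"
          using dv[of t] m h by (auto intro: has_field_derivative_subset)
        then show "(v has_derivative (*) (v' t)) (at t within {m..m + h})"
          by (simp add: has_field_derivative_def)
      qed (use h in auto)
      then obtain z where z: "m < z" "z < m + h" "v (m + h) - v m = v' z * h"
        by auto
      have zI: "z \<in> {0..1}" using z(1,2) h m by auto
      have "\<epsilon> z * v' z < 0" using d(2)[of "z - m"] z h zI by auto
      then have "v' z < 0" using \<epsilon>_pos[OF zI] by (simp add: mult_less_0_iff)
      then have "v (m + h) < v m" using z(3) h(1) mult_neg_pos[of "v' z" h] by auto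
      then show False using min[OF h(2)] by simp
    qed
  qed
  then show ?thesis using min[OF x] by linarith
qed

text \<open>Nonnegativity is applied to \<open>w + v\<close> and \<open>w - v\<close>; the strict
  inequality between the data makes both sources positive.\<close>

lemma sol_abs_le:
  assumes v: "sol g v v'" and w: "sol h w w'"
    and gh: "\<And>x. x \<in> {0..1} \<Longrightarrow> \<bar>g x\<bar> < h x"
    and left: "\<bar>v 0\<bar> \<le> w 0 \<or> \<bar>v' 0\<bar> \<le> - w' 0" and right: "\<bar>v 1\<bar> \<le> w 1"
    and x: "x \<in> {0..1}"
  shows "\<bar>v x\<bar> \<le> w x"
proof -
  have "w x + a * v x \<ge> 0" if a: "a = 1 \<or> a = - 1" for a
  proof (rule sol_nonneg[OF sol_linear[OF w v, of a] _ _ _ x])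
    show "h t + a * g t > 0" if "t \<in> {0..1}" for t
      using gh[OF that] a by auto
    show "w 0 + a * v 0 \<ge> 0 \<or> w' 0 + a * v' 0 \<le> 0"
      using left a by auto
    show "w 1 + a * v 1 \<ge> 0"
      using right a by auto
  qed
  from this[of 1] this[of "-1"] show ?thesis by simp
qed

section \<open>Barriers, the stretched variable and the integrating factor\<close>

text \<open>The term \<epsilon>' comes from differentiating the flux -M \<epsilon>. Being
  nonnegative, it leaves a source of at least M \<beta>, whatever the size of \<epsilon>.\<close>

lemma sol_linear_barrier:
  "sol (\<lambda>x. M * (\<epsilon>' x + b x + c x * (1 - x))) (\<lambda>x. M * (1 - x)) (\<lambda>x. - M)"
  unfolding sol_def
  by (auto intro!: derivative_eq_intros \<epsilon>_deriv simp: algebra_simps)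

lemma stretch_deriv:
  "x \<in> {0..1} \<Longrightarrow> (stretch \<epsilon> has_real_derivative 1 / \<epsilon> x) (at x within {0..1})"
  unfolding stretch_def
  by (rule integral_deriv01) (auto intro!: continuous_intros cont_\<epsilon> \<epsilon>_neq_0)

text \<open>Since e' = 1/\<epsilon>, the coefficient cancels in the flux, which is -M \<beta>
  exp(-\<beta> e). No derivative of \<epsilon> appears, and the gap b - \<beta> makes the source
  positive.\<close>

lemma sol_exp_barrier:
  "sol (\<lambda>x. M * ((\<beta> * (b x - \<beta>) / \<epsilon> x + c x) * exp (- \<beta> * stretch \<epsilon> x)))
     (\<lambda>x. M * exp (- \<beta> * stretch \<epsilon> x)) (\<lambda>x. M * (- \<beta> / \<epsilon> x * exp (- \<beta> * stretch \<epsilon> x)))"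
  unfolding sol_def
proof (intro ballI conjI)
  fix x :: real assume x: "x \<in> {0..1}"
  show "((\<lambda>x. M * exp (- \<beta> * stretch \<epsilon> x)) has_real_derivative
      M * (- \<beta> / \<epsilon> x * exp (- \<beta> * stretch \<epsilon> x))) (at x within {0..1})"
    by (auto intro!: derivative_eq_intros stretch_deriv[OF x])
  have "((\<lambda>t. - M * \<beta> * exp (- \<beta> * stretch \<epsilon> t)) has_real_derivative
      M * (\<beta>\<^sup>2 / \<epsilon> x * exp (- \<beta> * stretch \<epsilon> x))) (at x within {0..1})"
    by (auto intro!: derivative_eq_intros stretch_deriv[OF x] simp: power2_eq_square)
  then show "((\<lambda>t. \<epsilon> t * (M * (- \<beta> / \<epsilon> t * exp (- \<beta> * stretch \<epsilon> t)))) has_real_derivative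
      c x * (M * exp (- \<beta> * stretch \<epsilon> x)) - b x * (M * (- \<beta> / \<epsilon> x * exp (- \<beta> * stretch \<epsilon> x)))
      - M * ((\<beta> * (b x - \<beta>) / \<epsilon> x + c x) * exp (- \<beta> * stretch \<epsilon> x))) (at x within {0..1})"
    by (rule has_real_derivative_cong01[OF DERIV_cong x])
      (use x in \<open>auto simp: \<epsilon>_neq_0 field_simps power2_eq_square\<close>)
qed

lemma stretch_0: "stretch \<epsilon> 0 = 0"
  by (simp add: stretch_def)

lemma stretch_nonneg:
  assumes "x \<in> {0..1}"
  shows "stretch \<epsilon> x \<ge> 0"
proof -
  have "\<bar>0 - 0\<bar> \<le> stretch \<epsilon> x - stretch \<epsilon> 0"
  proof (rule abs_increment_le[where h = "\<lambda>_. 0" and h' = "\<lambda>_. 0", OF _ stretch_deriv _ assms])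
    show "((\<lambda>_. 0) has_real_derivative 0) (at t within {0..1})" for t
      by simp
    show "\<bar>0\<bar> \<le> 1 / \<epsilon> t" if "t \<in> {0..x}" for t
      using that assms \<epsilon>_pos[of t] by simp
  qed
  then show ?thesis by (simp add: stretch_0)
qed

definition P :: "real \<Rightarrow> real" where
  "P x = integral {0..x} (\<lambda>t. b t / \<epsilon> t)"

lemma P_0: "P 0 = 0"
  by (simp add: P_def)

lemma P_deriv: "x \<in> {0..1} \<Longrightarrow> (P has_real_derivative b x / \<epsilon> x) (at x within {0..1})"
  unfolding P_def
  by (rule integral_deriv01) (auto intro!: continuous_intros cont_b cont_\<epsilon> \<epsilon>_neq_0)

text \<open>Integrating \<beta> < b against 1/\<epsilon>. It allows the natural decay exp(-P) of the
  initial flux to be replaced by exp(-\<beta> e).\<close>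

lemma stretch_le_P:
  assumes "x \<in> {0..1}"
  shows "\<beta> * stretch \<epsilon> x \<le> P x"
proof -
  have "\<bar>\<beta> * stretch \<epsilon> x - \<beta> * stretch \<epsilon> 0\<bar> \<le> P x - P 0"
  proof (rule abs_increment_le[OF _ P_deriv _ assms])
    show "\<bar>\<beta> * (1 / \<epsilon> t)\<bar> \<le> b t / \<epsilon> t" if "t \<in> {0..x}" for t
      using that assms b_gt[of t] \<epsilon>_pos[of t] \<beta>_pos by (auto simp: field_simps)
  qed (auto intro!: derivative_eq_intros stretch_deriv)
  then show ?thesis by (simp add: P_0 stretch_0)
qed

lemma weighted_flux_deriv:
  assumes "sol g v v'" "x \<in> {0..1}"
  shows "((\<lambda>t. \<epsilon> t * v' t * exp (P t)) has_real_derivative (c x * v x - g x) * exp (P x))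
    (at x within {0..1})"
  by (rule derivative_eq_intros sol_deriv[OF assms] P_deriv[OF assms(2)] refl)+
    (use \<epsilon>_neq_0[OF assms(2)] in \<open>simp add: field_simps\<close>)

section \<open>Uniform bounds for the smooth part\<close>

text \<open>The value at 0 is unknown, so the comparison uses slopes there: the barrier M (1 - x)
  has slope -M, against slope 0 for \<open>v\<close>. The bound at 0 is thus a result; it controls
  S_0, and with g = 0 it also gives the uniqueness needed for shooting.\<close>

lemma smooth_part_bound:
  assumes v: "sol g v v'" and "v' 0 = 0" "v 1 = 0" and "M > 0"
    and g: "\<And>x. x \<in> {0..1} \<Longrightarrow> \<bar>g x\<bar> < M * \<beta>" and x: "x \<in> {0..1}"
  shows "\<bar>v x\<bar> \<le> M"
proof -
  have "\<bar>v x\<bar> \<le> M * (1 - x)"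
  proof (rule sol_abs_le[OF v sol_linear_barrier _ _ _ x])
    fix t :: real assume t: "t \<in> {0..1}"
    have "\<beta> \<le> \<epsilon>' t + b t + c t * (1 - t)"
      using b_gt[OF t] \<epsilon>'_nonneg[OF t] mult_nonneg_nonneg[OF c_nonneg[OF t], of "1 - t"] t by auto
    then have "M * \<beta> \<le> M * (\<epsilon>' t + b t + c t * (1 - t))"
      using \<open>M > 0\<close> by simp
    then show "\<bar>g t\<bar> < M * (\<epsilon>' t + b t + c t * (1 - t))"
      using g[OF t] by linarith
  qed (use assms in auto)
  also have "\<dots> \<le> M" using \<open>M > 0\<close> x by (simp add: mult_le_cancel_left1)
  finally show ?thesis .
qed

text \<open>Monotonicity of \<^term>\<open>\<epsilon>\<close> enters here: it makes \<open>(\<epsilon> exp P)' \<ge> \<beta> exp P\<close>.\<close>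

lemma smooth_part_deriv_bound:
  assumes v: "sol g v v'" and v'0: "v' 0 = 0"
    and R: "\<And>x. x \<in> {0..1} \<Longrightarrow> \<bar>c x * v x - g x\<bar> \<le> R" and x: "x \<in> {0..1}"
  shows "\<bar>v' x\<bar> \<le> R / \<beta>"
proof -
  have R0: "R \<ge> 0" using R[OF x] by linarith
  have "\<bar>\<epsilon> x * v' x * exp (P x) - \<epsilon> 0 * v' 0 * exp (P 0)\<bar>
      \<le> R / \<beta> * (\<epsilon> x * exp (P x)) - R / \<beta> * (\<epsilon> 0 * exp (P 0))"
  proof (rule abs_increment_le[OF weighted_flux_deriv[OF v] _ _ x])
    show "((\<lambda>t. R / \<beta> * (\<epsilon> t * exp (P t))) has_real_derivative
        R / \<beta> * ((\<epsilon>' t + b t) * exp (P t))) (at t within {0..1})" if "t \<in> {0..1}" for t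
      by (rule derivative_eq_intros \<epsilon>_deriv[OF that] P_deriv[OF that] refl)+
        (use \<epsilon>_neq_0[OF that] \<beta>_pos in \<open>simp add: field_simps\<close>)
    fix t assume "t \<in> {0..x}"
    then have t: "t \<in> {0..1}" using x by auto
    have "R * \<beta> \<le> R * (\<epsilon>' t + b t)"
      using R0 b_gt[OF t] \<epsilon>'_nonneg[OF t] by (intro mult_left_mono) auto
    then have "R \<le> R / \<beta> * (\<epsilon>' t + b t)"
      using \<beta>_pos by (simp add: field_simps)
    then have "\<bar>c t * v t - g t\<bar> * exp (P t) \<le> R / \<beta> * (\<epsilon>' t + b t) * exp (P t)"
      using R[OF t] by (intro mult_right_mono) auto
    then show "\<bar>(c t * v t - g t) * exp (P t)\<bar> \<le> R / \<beta> * ((\<epsilon>' t + b t) * exp (P t))"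
      by (simp add: abs_mult mult.assoc)
  qed
  \<comment> \<open>The contribution of the majorant at 0 has a favourable sign and is dropped; the
    initial flux on the left vanishes by \<open>v'0\<close>.\<close>
  also have "\<dots> \<le> R / \<beta> * (\<epsilon> x * exp (P x))"
    using R0 \<beta>_pos \<epsilon>_pos[of 0] by simp
  finally have "\<bar>v' x\<bar> * (\<epsilon> x * exp (P x)) \<le> R / \<beta> * (\<epsilon> x * exp (P x))"
    using \<epsilon>_pos[OF x] by (simp add: v'0 abs_mult mult_ac)
  then show ?thesis
    by (rule mult_right_le_imp_le) (use \<epsilon>_pos[OF x] in simp)
qed

section \<open>Exponentially decaying bounds for the layer part\<close>

text \<open>Here the value at 0 is controlled, and the barrier equals \<open>M\<close> there because
  e(0) = 0. Strictness of the comparison comes from b > \<beta>.\<close>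

lemma layer_part_bound:
  assumes v: "sol (\<lambda>x. 0) v v'" and "\<bar>v 0\<bar> \<le> M" "v 1 = 0" and "M > 0" and x: "x \<in> {0..1}"
  shows "\<bar>v x\<bar> \<le> M * exp (- \<beta> * stretch \<epsilon> x)"
proof (rule sol_abs_le[OF v sol_exp_barrier _ _ _ x])
  fix t :: real assume t: "t \<in> {0..1}"
  have "\<beta> * (b t - \<beta>) / \<epsilon> t + c t > 0"
    using \<beta>_pos b_gt[OF t] c_nonneg[OF t] \<epsilon>_pos[OF t]
    by (intro add_pos_nonneg divide_pos_pos mult_pos_pos) auto
  then show "\<bar>0\<bar> < M * ((\<beta> * (b t - \<beta>) / \<epsilon> t + c t) * exp (- \<beta> * stretch \<epsilon> t))"
    using \<open>M > 0\<close> by simp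
qed (use assms in \<open>auto simp: stretch_0\<close>)

text \<open>The flux at the boundary layer is controlled through \<open>(\<epsilon> v' + b v)' = (c + b') v\<close>, starting
  from a mean value point, where \<open>v'\<close> is bounded.\<close>

lemma layer_part_flux_bound:
  assumes v: "sol (\<lambda>x. 0) v v'" and M: "\<And>x. x \<in> {0..1} \<Longrightarrow> \<bar>v x\<bar> \<le> M" and "v 1 = 0"
    and b': "\<And>x. x \<in> {0..1} \<Longrightarrow> (b has_real_derivative b' x) (at x within {0..1})"
    and K: "\<And>x. x \<in> {0..1} \<Longrightarrow> \<bar>b x\<bar> \<le> K" "\<And>x. x \<in> {0..1} \<Longrightarrow> \<bar>b' x\<bar> \<le> K"
      "\<And>x. x \<in> {0..1} \<Longrightarrow> \<bar>c x\<bar> \<le> K"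
  shows "\<bar>\<epsilon> 0 * v' 0\<bar> \<le> M + 4 * (K * M)"
proof -
  define q where "q t = \<epsilon> t * v' t + b t * v t" for t
  have bv: "\<bar>b t * v t\<bar> \<le> K * M" if "t \<in> {0..1}" for t
    using M[OF that] K(1)[OF that] by (auto simp: abs_mult intro!: mult_mono)
  have "\<exists>z\<in>{0<..<1}. v 1 - v 0 = v' z * (1 - 0)"
    using sol_deriv(1)[OF v] by (intro mvt_simple) (auto simp: has_field_derivative_def)
  then obtain z where z: "0 < z" "z < 1" "v' z = - v 0"
    using \<open>v 1 = 0\<close> by auto
  then have zI: "z \<in> {0..1}" by simp
  have "\<bar>q z - q 0\<bar> \<le> 2 * (K * M) * z - 2 * (K * M) * 0"
  proof (rule abs_increment_le[OF _ _ _ zI])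
    show "(q has_real_derivative (c t + b' t) * v t) (at t within {0..1})" if "t \<in> {0..1}" for t
      unfolding q_def
      by (rule derivative_eq_intros sol_deriv[OF v that] b'[OF that] refl)+
        (simp add: algebra_simps)
    show "((*) (2 * (K * M)) has_real_derivative 2 * (K * M)) (at t within {0..1})" for t
      by (auto intro!: derivative_eq_intros)
    fix t assume "t \<in> {0..z}"
    then have t: "t \<in> {0..1}" using z by auto
    have "\<bar>(c t + b' t) * v t\<bar> \<le> (2 * K) * M"
      unfolding abs_mult using M[OF t] K(2,3)[OF t] by (intro mult_mono) auto
    then show "\<bar>(c t + b' t) * v t\<bar> \<le> 2 * (K * M)" by simp
  qed
  also have "\<dots> \<le> 2 * (K * M)"
    using z bv[OF zI] mult_left_le[of z "K * M"] by (simp add: mult.assoc)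
  finally have "\<bar>q z - q 0\<bar> \<le> 2 * (K * M)" .
  moreover have "\<bar>\<epsilon> z * v' z\<bar> \<le> 1 * M"
    unfolding abs_mult using \<epsilon>_le_1[OF zI] \<epsilon>_pos[OF zI] M[of 0] z(3) by (intro mult_mono) auto
  \<comment> \<open>The flux at \<open>z\<close> contributes \<open>M\<close> because \<epsilon> is
    at most 1. Integrating (c + b') v contributes 2 K M, and the terms b v at \<open>z\<close> and
    at 0 contribute K M each.\<close>
  ultimately show ?thesis
    using bv[OF zI] bv[of 0] unfolding q_def by auto
qed

text \<open>Weighted by exp P, the source c v is at most K M exp Q with Q = P - \<beta> e. As
  \<open>Q\<close> is nondecreasing, the integral of exp Q over [0,x] is at most x exp(Q x). This
  uses the sign of b - \<beta> without dividing by it. Removing the weight exp P turns exp Q back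
  into exp(-\<beta> e).\<close>

lemma layer_part_deriv_bound:
  assumes v: "sol (\<lambda>x. 0) v v'"
    and M: "\<And>x. x \<in> {0..1} \<Longrightarrow> \<bar>v x\<bar> \<le> M * exp (- \<beta> * stretch \<epsilon> x)"
    and W: "\<bar>\<epsilon> 0 * v' 0\<bar> \<le> W" and K: "\<And>x. x \<in> {0..1} \<Longrightarrow> \<bar>c x\<bar> \<le> K" and x: "x \<in> {0..1}"
  shows "\<bar>v' x\<bar> \<le> (W + K * M) / \<epsilon> x * exp (- \<beta> * stretch \<epsilon> x)"
proof -
  define Q where "Q t = P t - \<beta> * stretch \<epsilon> t" for t
  have dQ: "(Q has_real_derivative (b t - \<beta>) / \<epsilon> t) (at t within {0..1})" if "t \<in> {0..1}" for t
    unfolding Q_def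
    by (rule derivative_eq_intros P_deriv[OF that] stretch_deriv[OF that] refl)+
      (simp add: diff_divide_distrib)
  have KM: "K * M \<ge> 0"
    using K[of 0] M[of 0] by (auto simp: stretch_0)
  have "\<bar>\<epsilon> x * v' x * exp (P x) - \<epsilon> 0 * v' 0 * exp (P 0)\<bar>
      \<le> K * M * (x * exp (Q x)) - K * M * (0 * exp (Q 0))"
  proof (rule abs_increment_le[OF weighted_flux_deriv[OF v] _ _ x])
    show "((\<lambda>t. K * M * (t * exp (Q t))) has_real_derivative
        K * M * ((1 + t * ((b t - \<beta>) / \<epsilon> t)) * exp (Q t))) (at t within {0..1})"
      if "t \<in> {0..1}" for t
      by (rule derivative_eq_intros dQ[OF that] refl)+ (simp add: algebra_simps)
    fix t assume "t \<in> {0..x}"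
    then have t: "t \<in> {0..1}" using x by auto
    have "\<bar>c t * v t * exp (P t)\<bar> \<le> K * (M * exp (- \<beta> * stretch \<epsilon> t)) * exp (P t)"
      unfolding abs_mult using K[OF t] M[OF t] by (intro mult_mono) auto
    also have "\<dots> = K * M * (1 * exp (Q t))"
      by (simp add: Q_def exp_diff exp_minus divide_inverse)
    also have "\<dots> \<le> K * M * ((1 + t * ((b t - \<beta>) / \<epsilon> t)) * exp (Q t))"
      using KM t b_gt[OF t] \<epsilon>_pos[OF t] by (intro mult_left_mono mult_right_mono) auto
    finally show "\<bar>(c t * v t - 0) * exp (P t)\<bar> \<le> K * M * ((1 + t * ((b t - \<beta>) / \<epsilon> t)) * exp (Q t))"
      by simp
  qed
  moreover have "x * exp (Q x) \<le> exp (Q x)"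
    using x by simp
  then have "K * M * (x * exp (Q x)) \<le> K * M * exp (Q x)"
    using KM by (rule mult_left_mono)
  \<comment> \<open>The initial flux is absorbed because Q is nonnegative.\<close>
  moreover have "W * 1 \<le> W * exp (Q x)"
    using stretch_le_P[OF x] W by (intro mult_left_mono) (auto simp: Q_def)
  ultimately have "\<bar>\<epsilon> x * v' x * exp (P x)\<bar> \<le> (W + K * M) * exp (Q x)"
    using W by (simp add: P_0 algebra_simps)
  also have "\<dots> = (W + K * M) * exp (- \<beta> * stretch \<epsilon> x) * exp (P x)"
    by (simp add: Q_def exp_diff exp_minus divide_inverse)
  finally have "\<bar>v' x\<bar> * \<epsilon> x \<le> (W + K * M) * exp (- \<beta> * stretch \<epsilon> x)"
    using \<epsilon>_pos[OF x] by (simp add: abs_mult mult_ac)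
  then show ?thesis
    using \<epsilon>_pos[OF x] by (simp add: field_simps)
qed

section \<open>Existence for the initial value and the mixed problem\<close>

text \<open>The unknowns are \<open>v\<close> and the weighted flux m = \<epsilon> v' exp P. In
  these variables the homogeneous equation has no diagonal terms.\<close>

lemma initial_value_solution:
  obtains v v' where "sol (\<lambda>x. 0) v v'" "v 0 = p" "v' 0 = q"
proof -
  have cont_P: "continuous_on {0..1} P"
    using P_deriv by (rule DERIV_continuous_on)
  obtain k m where k0: "k 0 = p" and m0: "m 0 = \<epsilon> 0 * q"
    and k: "\<And>x. x \<in> {0..1} \<Longrightarrow> (k has_real_derivative exp (- P x) / \<epsilon> x * m x) (at x within {0..1})"
    and m: "\<And>x. x \<in> {0..1} \<Longrightarrow> (m has_real_derivative exp (P x) * c x * k x) (at x within {0..1})"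
  proof -
    have "continuous_on {0..1} (\<lambda>x. exp (- P x) / \<epsilon> x)"
      by (intro continuous_intros cont_P cont_\<epsilon>) (use \<epsilon>_neq_0 in auto)
    moreover have "continuous_on {0..1} (\<lambda>x. exp (P x) * c x)"
      by (intro continuous_intros cont_P cont_c)
    ultimately show thesis
      using linear_system_solution that by blast
  qed
  define v' where "v' x = exp (- P x) / \<epsilon> x * m x" for x
  have "sol (\<lambda>x. 0) k v'"
    unfolding sol_def
  proof (intro ballI conjI)
    fix x :: real assume x: "x \<in> {0..1}"
    show "(k has_real_derivative v' x) (at x within {0..1})"
      using k[OF x] by (simp add: v'_def)
    have "((\<lambda>t. exp (- P t) * m t) has_real_derivative c x * k x - b x * v' x - 0) (at x within {0..1})"
      by (rule derivative_eq_intros m[OF x] P_deriv[OF x] refl)+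
        (simp add: v'_def exp_minus field_simps)
    then show "((\<lambda>t. \<epsilon> t * v' t) has_real_derivative c x * k x - b x * v' x - 0) (at x within {0..1})"
      by (rule has_real_derivative_cong01[OF _ x]) (auto simp: v'_def \<epsilon>_neq_0)
  qed
  moreover have "v' 0 = q"
    using \<epsilon>_neq_0[of 0] by (simp add: v'_def P_0 m0)
  ultimately show thesis using that k0 by blast
qed

text \<open>Shooting: a solution with slope \<open>a\<close> at 0 is corrected by a multiple of a
  solution \<open>w\<close> with slope 0, which leaves the slope intact. This works because w(1) is
  nonzero.\<close>

lemma mixed_problem_solution:
  obtains v v' where "sol (\<lambda>x. 0) v v'" "v' 0 = a" "v 1 = 0"
proof -
  obtain w w' where w: "sol (\<lambda>x. 0) w w'" "w 0 = 1" "w' 0 = 0"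
    using initial_value_solution by metis
  have "w 1 \<noteq> 0"
  proof
    assume "w 1 = 0"
    \<comment> \<open>With zero right-hand side every positive bound is admissible; 1/2 already
      contradicts w(0) = 1.\<close>
    then have "\<bar>w 0\<bar> \<le> 1 / 2"
      using w \<beta>_pos by (intro smooth_part_bound[OF w(1)]) auto
    with w(2) show False by simp
  qed
  obtain y y' where y: "sol (\<lambda>x. 0) y y'" "y 0 = 0" "y' 0 = a"
    using initial_value_solution by metis
  define s where "s = - y 1 / w 1"
  have "sol (\<lambda>x. 0) (\<lambda>x. y x + s * w x) (\<lambda>x. y' x + s * w' x)"
    using sol_linear[OF y(1) w(1), of s] by simp
  then show thesis
    by (rule that) (use \<open>w 1 \<noteq> 0\<close> y(3) w(3) in \<open>auto simp: s_def\<close>)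
qed

section \<open>Second derivatives and the link with classical solutions\<close>

lemma sol_second_deriv:
  assumes v: "sol g v v'" and x: "x \<in> {0..1}"
  shows "(v' has_real_derivative (c x * v x - b x * v' x - g x - \<epsilon>' x * v' x) / \<epsilon> x) (at x within {0..1})"
proof (rule has_real_derivative_cong01[OF _ x])
  show "((\<lambda>t. \<epsilon> t * v' t / \<epsilon> t) has_real_derivative
      (c x * v x - b x * v' x - g x - \<epsilon>' x * v' x) / \<epsilon> x) (at x within {0..1})"
    by (rule derivative_eq_intros sol_deriv(2)[OF v x] \<epsilon>_deriv[OF x] refl \<epsilon>_neq_0[OF x])+
      (use \<epsilon>_neq_0[OF x] in \<open>simp add: field_simps\<close>)
qed (auto simp: \<epsilon>_neq_0)

lemma sol_deriv01:
  assumes v: "sol g v v'" and x: "x \<in> {0..1}"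
  shows "deriv01 v x = v' x"
    and "deriv01 (deriv01 v) x = (c x * v x - b x * v' x - g x - \<epsilon>' x * v' x) / \<epsilon> x"
proof -
  have 1: "deriv01 v t = v' t" if "t \<in> {0..1}" for t
    using sol_deriv(1)[OF v that] that by (rule deriv01_eq)
  then show "deriv01 v x = v' x" using x .
  show "deriv01 (deriv01 v) x = (c x * v x - b x * v' x - g x - \<epsilon>' x * v' x) / \<epsilon> x"
    using 1 x sol_second_deriv[OF v x] by (intro deriv01_cong[of v']) auto
qed

text \<open>The bounds \<open>r\<close> and \<open>s\<close> are local to the point
  \<open>x\<close>, so the same estimate serves \<open>S\<close> with constants and \<open>E\<close>
  with multiples of exp(-\<beta> e)/\<epsilon>. The factor 1 + \<epsilon>' is the price of expanding
  (\<epsilon> v')'; the unexpanded flux derivative is bounded without it.\<close>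

lemma residual_bounds:
  assumes r: "\<bar>c x * v x - g x\<bar> \<le> r" and s: "\<bar>v' x\<bar> \<le> s" and K: "\<bar>b x\<bar> \<le> K" and x: "x \<in> {0..1}"
  shows "\<bar>c x * v x - b x * v' x - g x\<bar> \<le> r + K * s"
    and "\<bar>c x * v x - b x * v' x - g x - \<epsilon>' x * v' x\<bar> \<le> (r + (K + 1) * s) * (1 + \<epsilon>' x)"
proof -
  have 0: "r \<ge> 0" "s \<ge> 0" "K \<ge> 0" "\<epsilon>' x \<ge> 0"
    using r s K \<epsilon>'_nonneg[OF x] by linarith+
  have "\<bar>b x * v' x\<bar> \<le> K * s" "\<bar>\<epsilon>' x * v' x\<bar> \<le> \<epsilon>' x * s"
    using s K 0 by (auto simp: abs_mult intro!: mult_mono)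
  moreover have "r * \<epsilon>' x \<ge> 0" "K * s * \<epsilon>' x \<ge> 0" "s * \<epsilon>' x \<ge> 0"
    using 0 by auto
  ultimately show "\<bar>c x * v x - b x * v' x - g x\<bar> \<le> r + K * s"
    and "\<bar>c x * v x - b x * v' x - g x - \<epsilon>' x * v' x\<bar> \<le> (r + (K + 1) * s) * (1 + \<epsilon>' x)"
    using r \<open>s \<ge> 0\<close> by (simp_all add: algebra_simps abs_le_iff)
qed

lemma sol_imp_solves_bvp:
  assumes v: "sol g v v'" and g: "continuous_on {0..1} g"
  shows "solves_bvp b c \<epsilon> g (v 0) (v 1) v"
proof -
  note d = sol_deriv01[OF v]
  have dv: "(v has_real_derivative deriv01 v x) (at x within {0..1})"
    and dv': "(deriv01 v has_real_derivative deriv01 (deriv01 v) x) (at x within {0..1})"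
    if "x \<in> {0..1}" for x
    unfolding d[OF that]
    by (rule sol_deriv(1)[OF v that])
      (rule has_real_derivative_cong01[OF sol_second_deriv[OF v that] that], simp add: d)
  have "continuous_on {0..1} v" "continuous_on {0..1} v'"
    by (rule DERIV_continuous_on[OF sol_deriv(1)[OF v]], assumption)
      (rule DERIV_continuous_on[OF sol_second_deriv[OF v]], assumption)
  then have "continuous_on {0..1} (\<lambda>x. (c x * v x - b x * v' x - g x - \<epsilon>' x * v' x) / \<epsilon> x)"
    by (intro continuous_intros cont_b cont_c cont_\<epsilon> cont_\<epsilon>' g) (auto simp: \<epsilon>_neq_0)
  then have "continuous_on {0..1} (deriv01 (deriv01 v))"
    by (rule continuous_on_eq) (simp add: d(2))
  moreover have "(deriv01 ^^ j) v differentiable_on {0..1}" if "j < 2" for j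
  proof -
    have "v differentiable_on {0..1}" "deriv01 v differentiable_on {0..1}"
      unfolding differentiable_on_def real_differentiable_def using dv dv' by blast+
    moreover have "j = 0 \<or> j = 1" using that by auto
    ultimately show ?thesis by auto
  qed
  ultimately have "Ck01 2 v"
    by (simp add: Ck01_def numeral_2_eq_2)
  moreover have "Lop b c \<epsilon> v x = g x" if "x \<in> {0<..<1}" for x
  proof -
    have x: "x \<in> {0..1}" using that by auto
    have "deriv01 (\<lambda>t. \<epsilon> t * deriv01 v t) x = c x * v x - b x * v' x - g x"
      using sol_deriv(2)[OF v x] x d(1) by (intro deriv01_cong[of "\<lambda>t. \<epsilon> t * v' t"]) auto
    then show ?thesis by (simp add: Lop_def d(1)[OF x])
  qed
  ultimately show ?thesis by (simp add: solves_bvp_def)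
qed

text \<open>The equation is given only in the open interval. Continuity of the second derivative up
  to the boundary carries the vanishing residual over to the endpoints.\<close>

lemma solves_bvp_imp_sol:
  assumes "solves_bvp b c \<epsilon> g v0 v1 v" and g: "continuous_on {0..1} g"
  shows "sol g v (deriv01 v)"
proof -
  have Ck: "Ck01 2 v" and L: "\<And>x. x \<in> {0<..<1} \<Longrightarrow> Lop b c \<epsilon> v x = g x"
    using assms(1) by (auto simp: solves_bvp_def)
  have dv: "(v has_real_derivative deriv01 v x) (at x within {0..1})"
    and dv': "(deriv01 v has_real_derivative deriv01 (deriv01 v) x) (at x within {0..1})"
    if "x \<in> {0..1}" for x
    using Ck01_has_real_derivative[OF Ck, of 0 x] Ck01_has_real_derivative[OF Ck, of 1 x] that
    by simp_all
  define F where "F x = \<epsilon>' x * deriv01 v x + \<epsilon> x * deriv01 (deriv01 v) x" for x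
  have dF: "((\<lambda>t. \<epsilon> t * deriv01 v t) has_real_derivative F x) (at x within {0..1})"
    if "x \<in> {0..1}" for x
    unfolding F_def by (rule derivative_eq_intros \<epsilon>_deriv[OF that] dv'[OF that] refl)+ simp
  have "- F x - b x * deriv01 v x + c x * v x - g x = 0" if "x \<in> {0..1}" for x
  proof (rule continuous_constant_on_closure[where S = "{0<..<1::real}" and x = x])
    have "continuous_on {0..1} v" "continuous_on {0..1} (deriv01 v)"
      by (rule DERIV_continuous_on[OF dv], assumption) (rule DERIV_continuous_on[OF dv'], assumption)
    moreover have "continuous_on {0..1} (deriv01 (deriv01 v))"
      using Ck by (simp add: Ck01_def numeral_2_eq_2)
    ultimately show "continuous_on (closure {0<..<1}) (\<lambda>x. - F x - b x * deriv01 v x + c x * v x - g x)"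
      unfolding F_def by (auto intro!: continuous_intros cont_b cont_c cont_\<epsilon> cont_\<epsilon>' g)
    show "- F x - b x * deriv01 v x + c x * v x - g x = 0" if "x \<in> {0<..<1}" for x
      using L[OF that] deriv01_eq[OF dF, of x] that by (simp add: Lop_def)
  qed (use that in auto)
  then have "F x = c x * v x - b x * deriv01 v x - g x" if "x \<in> {0..1}" for x
    using that by (force simp: algebra_simps)
  then show ?thesis
    unfolding sol_def using dv dF by auto
qed

end

section \<open>Choice of the constant and assembly of the decomposition\<close>

theorem theorem10:
  fixes b c f :: "real \<Rightarrow> real" and \<beta> \<gamma> :: real
  assumes "smooth01 b" and "smooth01 c" and "smooth01 f"
    and "\<beta> > 0" and "\<gamma> > 0"
    and "\<forall>x\<in>{0..1}. b x > \<beta>"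
    and "\<forall>x\<in>{0..1}. c x \<ge> 0"
    and "\<forall>x\<in>{0..1}. c x + deriv01 b x / 2 \<ge> \<gamma>"
  shows "\<exists>C::real. \<forall>(\<epsilon>::real \<Rightarrow> real) (\<epsilon>_lo::real) (\<epsilon>_hi::real) (u::real \<Rightarrow> real).
    smooth01 \<epsilon> \<and> 0 < \<epsilon>_lo \<and> (\<forall>x\<in>{0..1}. \<epsilon>_lo \<le> \<epsilon> x \<and> \<epsilon> x \<le> \<epsilon>_hi) \<and> \<epsilon>_hi \<le> 1 \<and>
    (\<forall>x\<in>{0..1}. deriv01 \<epsilon> x \<ge> 0) \<and>
    solves_bvp b c \<epsilon> f 0 0 u \<longrightarrow>
    (\<exists>(S0::real) (S::real \<Rightarrow> real) (E::real \<Rightarrow> real).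
      \<bar>S0\<bar> \<le> C \<and>
      (\<forall>x\<in>{0..1}. u x = S x + E x) \<and>
      solves_bvp b c \<epsilon> f S0 0 S \<and>
      solves_bvp b c \<epsilon> (\<lambda>x. 0) (- S0) 0 E \<and>
      (\<forall>x\<in>{0..1}.
        (\<forall>k\<in>{0,1}. \<bar>(deriv01 ^^ k) S x\<bar> \<le> C) \<and>
        \<bar>(deriv01 ^^ 2) S x\<bar> \<le> C * ((1 + deriv01 \<epsilon> x) / \<epsilon> x) \<and>
        \<bar>\<epsilon> x * (deriv01 ^^ 2) S x + deriv01 \<epsilon> x * deriv01 S x\<bar> \<le> C \<and>
        (\<forall>k\<in>{0,1}. \<bar>(deriv01 ^^ k) E x\<bar> \<le> C * (1 / \<epsilon> x ^ k) * exp (- \<beta> * stretch \<epsilon> x)) \<and>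
        \<bar>(deriv01 ^^ 2) E x\<bar> \<le>
          C * ((1 + deriv01 \<epsilon> x) / (\<epsilon> x)\<^sup>2) * exp (- \<beta> * stretch \<epsilon> x)))"
proof -
  note cont = smooth01_continuous_on[OF assms(1)] smooth01_continuous_on(1)[OF assms(2)]
    smooth01_continuous_on(1)[OF assms(3)]
  obtain K1 K2 K3 K4 where K1234: "\<And>x. x \<in> {0..1} \<Longrightarrow> \<bar>b x\<bar> \<le> K1"
    "\<And>x. x \<in> {0..1} \<Longrightarrow> \<bar>deriv01 b x\<bar> \<le> K2"
    "\<And>x. x \<in> {0..1} \<Longrightarrow> \<bar>c x\<bar> \<le> K3" "\<And>x. x \<in> {0..1} \<Longrightarrow> \<bar>f x\<bar> \<le> K4"
    using cont continuous_on_bound01 by metis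
  define K where "K = Max {K1, K2, K3, K4}"
  have K: "\<bar>b x\<bar> \<le> K" "\<bar>deriv01 b x\<bar> \<le> K" "\<bar>c x\<bar> \<le> K" "\<bar>f x\<bar> \<le> K" if "x \<in> {0..1}" for x
    using K1234[OF that] by (auto simp: K_def)
  have K0: "K \<ge> 0" using K(1)[of 0] by auto
  \<comment> \<open>The added 1 gives |f| < M \<beta> strictly, as the comparison for
    \<open>S\<close> requires. Below, \<open>R\<close> bounds |c S - f|, and \<open>N\<close> adds
    the source contribution K M to the bound on the initial flux of \<open>E\<close>.
    \<open>C\<close> sums nonnegative groups so as to dominate each constant needed.\<close>
  define M where "M = (K + 1) / \<beta>"
  define R where "R = K * M + K"
  define N where "N = M + 4 * (K * M) + K * M"
  define C where "C = M + (R + (K + 1) * (R / \<beta>)) + (K * M + (K + 1) * N)"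
  have M: "M > 0" using K0 \<open>\<beta> > 0\<close> by (simp add: M_def)
  have KM: "K * M \<ge> 0" using K0 M by simp
  have R: "R \<ge> 0" "R / \<beta> \<ge> 0" and N: "N \<ge> 0" using KM K0 M \<open>\<beta> > 0\<close> by (auto simp: R_def N_def)
  have pos: "(K + 1) * (R / \<beta>) \<ge> 0" "(K + 1) * N \<ge> 0" "K * (R / \<beta>) \<ge> 0" "K * N \<ge> 0"
    by (intro mult_nonneg_nonneg add_nonneg_nonneg K0 R N zero_le_one)+
  have C: "M \<le> C" "R / \<beta> \<le> C" "R + K * (R / \<beta>) \<le> C" "R + (K + 1) * (R / \<beta>) \<le> C"
    "N \<le> C" "K * M + (K + 1) * N \<le> C"
    unfolding C_def distrib_right using pos R N M KM by simp_all
  show ?thesis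
  proof (rule exI[of _ C], intro allI impI, elim conjE)
    fix \<epsilon> u :: "real \<Rightarrow> real" and \<epsilon>_lo \<epsilon>_hi :: real
    assume \<epsilon>: "smooth01 \<epsilon>" "0 < \<epsilon>_lo" "\<forall>x\<in>{0..1}. \<epsilon>_lo \<le> \<epsilon> x \<and> \<epsilon> x \<le> \<epsilon>_hi" "\<epsilon>_hi \<le> 1"
      "\<forall>x\<in>{0..1}. deriv01 \<epsilon> x \<ge> 0"
      and u: "solves_bvp b c \<epsilon> f 0 0 u"
    define \<epsilon>' where "\<epsilon>' = deriv01 \<epsilon>"
    interpret layer_problem b c \<epsilon> \<epsilon>' \<beta>
    proof
      fix x :: real assume x: "x \<in> {0..1}"
      show "\<beta> < b x" "0 \<le> c x" "0 \<le> \<epsilon>' x" "0 < \<epsilon> x" "\<epsilon> x \<le> 1"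
        using x assms(6,7) \<epsilon>(2-5) by (fastforce simp: \<epsilon>'_def)+
      show "(\<epsilon> has_real_derivative \<epsilon>' x) (at x within {0..1})"
        using smooth01_has_real_derivative[OF \<epsilon>(1) x] by (simp add: \<epsilon>'_def)
    qed (use assms(4) cont smooth01_continuous_on(2)[OF \<epsilon>(1)] in \<open>simp_all add: \<epsilon>'_def\<close>)
    have solu: "sol f u (deriv01 u)" and u01: "u 0 = 0" "u 1 = 0"
      using solves_bvp_imp_sol[OF u cont(4)] u by (auto simp: solves_bvp_def)
    obtain E E' where E: "sol (\<lambda>x. 0) E E'" "E' 0 = deriv01 u 0" "E 1 = 0"
      using mixed_problem_solution .
    \<comment> \<open>\<open>E\<close> has the slope of \<open>u\<close> at 0, so the difference has
      slope 0 there; S_0 is read off as its value at 0.\<close>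
    define S where "S x = u x - E x" for x
    define S' where "S' x = deriv01 u x - E' x" for x
    have S: "sol f S S'" "S' 0 = 0" "S 1 = 0"
      using sol_linear[OF solu E(1), of "- 1"] E u01 by (auto simp: S_def[abs_def] S'_def[abs_def])
    have E0: "E 0 = - S 0" by (simp add: S_def u01)
    define B where "B x = exp (- \<beta> * stretch \<epsilon> x)" for x
    have Sbd: "\<bar>S x\<bar> \<le> M" if "x \<in> {0..1}" for x
    proof (rule smooth_part_bound[OF S M _ that])
      show "\<bar>f t\<bar> < M * \<beta>" if "t \<in> {0..1}" for t
        using K(4)[OF that] \<open>\<beta> > 0\<close> by (simp add: M_def)
    qed
    have Sr: "\<bar>c x * S x - f x\<bar> \<le> R" if "x \<in> {0..1}" for x
    proof -
      have "\<bar>c x * S x\<bar> \<le> K * M"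
        unfolding abs_mult using K(3)[OF that] Sbd[OF that] by (intro mult_mono) auto
      then show ?thesis using K(4)[OF that] by (simp add: R_def)
    qed
    have S'bd: "\<bar>S' x\<bar> \<le> R / \<beta>" if "x \<in> {0..1}" for x
      using smooth_part_deriv_bound[OF S(1,2) Sr that] .
    have Ebd: "\<bar>E x\<bar> \<le> M * B x" if "x \<in> {0..1}" for x
      unfolding B_def by (rule layer_part_bound[OF E(1) _ E(3) M that]) (use Sbd[of 0] in \<open>simp add: E0\<close>)
    have EM: "\<bar>E x\<bar> \<le> M" if "x \<in> {0..1}" for x
    proof -
      have "B x \<le> 1" using stretch_nonneg[OF that] \<open>\<beta> > 0\<close> by (simp add: B_def)
      then have "M * B x \<le> M * 1" using M by (intro mult_left_mono) auto
      then show ?thesis using Ebd[OF that] by simp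
    qed
    have "\<bar>\<epsilon> 0 * E' 0\<bar> \<le> M + 4 * (K * M)"
      using smooth01_has_real_derivative[OF assms(1)] K E(3)
      by (intro layer_part_flux_bound[OF E(1) EM]) auto
    then have E'bd: "\<bar>E' x\<bar> \<le> N / \<epsilon> x * B x" if "x \<in> {0..1}" for x
      unfolding B_def N_def using Ebd K(3) that unfolding B_def
      by (intro layer_part_deriv_bound[OF E(1)]) auto
    note dS = sol_deriv01[OF S(1)] and dE = sol_deriv01[OF E(1)]
    have "\<bar>S x\<bar> \<le> C \<and> \<bar>deriv01 S x\<bar> \<le> C \<and>
        \<bar>deriv01 (deriv01 S) x\<bar> \<le> C * ((1 + \<epsilon>' x) / \<epsilon> x) \<and>
        \<bar>\<epsilon> x * deriv01 (deriv01 S) x + \<epsilon>' x * deriv01 S x\<bar> \<le> C" if x: "x \<in> {0..1}" for x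
    proof (intro conjI)
      show "\<bar>S x\<bar> \<le> C" "\<bar>deriv01 S x\<bar> \<le> C"
        using Sbd[OF x] S'bd[OF x] C dS(1)[OF x] by auto
      note res = residual_bounds[where v = S and v' = S' and g = f, OF Sr[OF x] S'bd[OF x] K(1)[OF x] x]
      have "\<epsilon> x * deriv01 (deriv01 S) x + \<epsilon>' x * deriv01 S x = c x * S x - b x * S' x - f x"
        using \<epsilon>_neq_0[OF x] by (simp add: dS[OF x])
      then show "\<bar>\<epsilon> x * deriv01 (deriv01 S) x + \<epsilon>' x * deriv01 S x\<bar> \<le> C"
        using res(1) C(3) by simp
      have "(R + (K + 1) * (R / \<beta>)) * (1 + \<epsilon>' x) \<le> C * (1 + \<epsilon>' x)"
        using C(4) \<epsilon>'_nonneg[OF x] by (intro mult_right_mono) auto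
      with res(2) show "\<bar>deriv01 (deriv01 S) x\<bar> \<le> C * ((1 + \<epsilon>' x) / \<epsilon> x)"
        using \<epsilon>_pos[OF x] by (simp add: dS[OF x] abs_divide divide_le_cancel)
    qed
    moreover have "\<bar>E x\<bar> \<le> C * B x \<and> \<bar>deriv01 E x\<bar> \<le> C * (1 / \<epsilon> x) * B x \<and>
        \<bar>deriv01 (deriv01 E) x\<bar> \<le> C * ((1 + \<epsilon>' x) / (\<epsilon> x)\<^sup>2) * B x" if x: "x \<in> {0..1}" for x
    proof (intro conjI)
      have B: "B x > 0" by (simp add: B_def)
      note \<epsilon>x = \<epsilon>_pos[OF x]
      have "M * B x \<le> C * B x" using C(1) B by simp
      then show "\<bar>E x\<bar> \<le> C * B x" using Ebd[OF x] by simp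
      have "N / \<epsilon> x * B x \<le> C * (1 / \<epsilon> x) * B x"
        using C(5) B \<epsilon>x by (simp add: divide_right_mono)
      then show "\<bar>deriv01 E x\<bar> \<le> C * (1 / \<epsilon> x) * B x"
        using E'bd[OF x] by (simp add: dE(1)[OF x])
      have "\<bar>c x * E x - 0\<bar> \<le> K * (M * B x)"
        using K(3)[OF x] Ebd[OF x] K0 by (auto simp: abs_mult intro!: mult_mono)
      \<comment> \<open>Since \<epsilon> is at most 1, the reaction term can be given the same
        factor exp(-\<beta> e)/\<epsilon> as the bound for E'. Solving for the second derivative
        then costs one more power of \<epsilon>.\<close>
      also have "\<dots> \<le> K * M * B x / \<epsilon> x"
        using \<epsilon>_le_1[OF x] \<epsilon>x mult_nonneg_nonneg[OF KM, of "B x"] B mult_left_le[of "\<epsilon> x" "K * M * B x"]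
        by (simp add: pos_le_divide_eq mult.assoc)
      finally have "\<bar>c x * E x - 0\<bar> \<le> K * M * B x / \<epsilon> x" .
      note res = residual_bounds(2)[where v = E and v' = E' and g = "\<lambda>_. 0", OF this E'bd[OF x] K(1)[OF x] x]
      have "K * M * B x / \<epsilon> x + (K + 1) * (N / \<epsilon> x * B x) = (K * M + (K + 1) * N) * (B x / \<epsilon> x)"
        by (simp add: algebra_simps add_divide_distrib)
      also have "\<dots> \<le> C * (B x / \<epsilon> x)"
        using C(6) B \<epsilon>x by (intro mult_right_mono) auto
      finally have "(K * M * B x / \<epsilon> x + (K + 1) * (N / \<epsilon> x * B x)) * (1 + \<epsilon>' x)
          \<le> C * (B x / \<epsilon> x) * (1 + \<epsilon>' x)"
        using \<epsilon>'_nonneg[OF x] by (intro mult_right_mono) auto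
      with res have "\<bar>\<epsilon> x * deriv01 (deriv01 E) x\<bar> \<le> C * (B x / \<epsilon> x) * (1 + \<epsilon>' x)"
        using \<epsilon>x by (simp add: dE(2)[OF x])
      then show "\<bar>deriv01 (deriv01 E) x\<bar> \<le> C * ((1 + \<epsilon>' x) / (\<epsilon> x)\<^sup>2) * B x"
        using \<epsilon>x by (simp add: abs_mult power2_eq_square field_simps)
    qed
    moreover have "solves_bvp b c \<epsilon> f (S 0) 0 S" "solves_bvp b c \<epsilon> (\<lambda>x. 0) (- S 0) 0 E"
      using sol_imp_solves_bvp[OF S(1) cont(4)] sol_imp_solves_bvp[OF E(1)] S(3) E(3) E0 by auto
    moreover have "\<bar>S 0\<bar> \<le> C" "\<forall>x\<in>{0..1}. u x = S x + E x"
      using Sbd[of 0] C(1) by (auto simp: S_def)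
    ultimately     show "\<exists>S0 S E. \<bar>S0\<bar> \<le> C \<and>
      (\<forall>x\<in>{0..1}. u x = S x + E x) \<and>
      solves_bvp b c \<epsilon> f S0 0 S \<and>
      solves_bvp b c \<epsilon> (\<lambda>x. 0) (- S0) 0 E \<and>
      (\<forall>x\<in>{0..1}.
        (\<forall>k\<in>{0,1}. \<bar>(deriv01 ^^ k) S x\<bar> \<le> C) \<and>
        \<bar>(deriv01 ^^ 2) S x\<bar> \<le> C * ((1 + deriv01 \<epsilon> x) / \<epsilon> x) \<and>
        \<bar>\<epsilon> x * (deriv01 ^^ 2) S x + deriv01 \<epsilon> x * deriv01 S x\<bar> \<le> C \<and>
        (\<forall>k\<in>{0,1}. \<bar>(deriv01 ^^ k) E x\<bar> \<le> C * (1 / \<epsilon> x ^ k) * exp (- \<beta> * stretch \<epsilon> x)) \<and>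
        \<bar>(deriv01 ^^ 2) E x\<bar> \<le>
          C * ((1 + deriv01 \<epsilon> x) / (\<epsilon> x)\<^sup>2) * exp (- \<beta> * stretch \<epsilon> x))"
      unfolding B_def \<epsilon>'_def numeral_2_eq_2
      by (intro exI[of _ "S 0"] exI[of _ S] exI[of _ E]) simp
  qed
qed

end
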